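(* Let $m\ge 1$ and let $A_1,\dots,A_m$ be a reduced set of patterns over a finite alphabet $\Omega$. For each $1\le i\le m$ with $Pr(\tau=\tau_i)>0$, $$ E({\tau}\,|\,\tau=\tau_i)= E\tau+\frac{1}{Pr(\tau=\tau_i)}\cdot \frac{d}{ds}\Big(\frac{\det\mathcal{B}^i}{\sum_{j=1}^{m}\det \mathcal{B}^j}\Big)(1), $$ where the last factor is the derivative at $s=1$ of the rational function $s\mapsto \det\mathcal{B}^i(s)/\sum_{j=1}^{m}\det \mathcal{B}^j(s)$.
   Context: Let $(\xi_n)_{n\ge1}$ be a sequence of i.i.d. random letters from a finite alphabet $\Omega$. For a pattern (word) $A=(a_1,\dots,a_l)\in\Omega^l$, $l\ge 1$, put $Pr(A)=\prod_{k=1}^l Pr(\xi_1=a_k)$; $A_{(k)}=(a_1,\dots,a_k)$ and $A^{(k)}=(a_{l-k+1},\dots,a_l)$ denote the words formed by its first and last $k$ letters, and $Pr(A^{(0)})=1$. For words $U,V$, $[U=V]$ is $1$ if $U=V$ and $0$ otherwise. For patterns $A$, $B$ of lengths $l$, $m'$, the correlation polynomial is $$w_A^B(s)=\sum_{k=1}^{\min\{l,m'\}}[A_{(k)}=B^{(k)}]\,Pr(A^{(l-k)})\,s^{l-k}.$$ A set of $m$ patterns $A_1,\dots,A_m$ of lengths $l_1,\dots,l_m$ is reduced if none of the patterns contains any other as a subpattern (i.e. as a block of consecutive letters). Let $\tau_i$ be the stopping time until $A_i$ occurs, i.e. the least $n\ge l_i$ with $(\xi_{n-l_i+1},\dots,\xi_n)=A_i$,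 and $\tau=\min\{\tau_i:1\le i\le m\}$. The event $\{\tau=\tau_i\}$ means that $A_i$ occurs, at a finite time, before all the other patterns, so $Pr(\tau=\tau_i)=\sum_{n}Pr(\tau=\tau_i=n)$. $E(\tau\,|\,\tau=\tau_i)$ is the conditional expectation of $\tau$ given this event, i.e. $\sum_{n\ge1} n\,Pr(\tau=n\,|\,\tau=\tau_i)$. Let $\mathcal{B}(s)=[w_{A_i}^{A_j}(s)]_{1\le i,j\le m}$ (row index $i$, column index $j$), and let $\mathcal{B}^j(s)$ be the matrix obtained by replacing the $j$-th column of $\mathcal{B}(s)$ by the column vector $[Pr(A_i)s^{l_i}]_{1\le i\le m}$. Values at $s=1$ of rational functions in $s$ are understood as limits as $s\to1^-$ (removable singularities being removed). *)

theory Defs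
  imports "HOL-Probability.Probability" "HOL-Library.Sublist"
begin

(* The letter X n is read for n \<ge> 1 only; X 0 never enters. *)

definition occurs_at :: "(nat \<Rightarrow> 'a) \<Rightarrow> 'a list \<Rightarrow> nat \<Rightarrow> bool" where
  "occurs_at X A n \<longleftrightarrow> length A \<le> n \<and> map X [n - length A + 1 ..< n + 1] = A"

(* The value is \<infinity> if the pattern never occurs. *)
definition hit_time :: "(nat \<Rightarrow> 'w \<Rightarrow> 'a) \<Rightarrow> 'a list \<Rightarrow> 'w \<Rightarrow> enat" where
  "hit_time \<xi> A \<omega> = (INF n \<in> {n. occurs_at (\<lambda>k. \<xi> k \<omega>) A n}. enat n)"

definition first_hit :: "(nat \<Rightarrow> 'w \<Rightarrow> 'a) \<Rightarrow> ('m::finite \<Rightarrow> 'a list) \<Rightarrow> 'w \<Rightarrow> enat" where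
  "first_hit \<xi> A \<omega> = Min (range (\<lambda>i. hit_time \<xi> (A i) \<omega>))"

(* The event {\<tau> = \<tau>_i}; finiteness is imposed explicitly because \<tau> and \<tau>_i also agree
   when both are infinite. *)
definition wins :: "(nat \<Rightarrow> 'w \<Rightarrow> 'a) \<Rightarrow> ('m::finite \<Rightarrow> 'a list) \<Rightarrow> 'm \<Rightarrow> 'w \<Rightarrow> bool" where
  "wins \<xi> A i \<omega> \<longleftrightarrow> first_hit \<xi> A \<omega> = hit_time \<xi> (A i) \<omega> \<and> first_hit \<xi> A \<omega> < \<infinity>"

definition reduced_patterns :: "('m \<Rightarrow> 'a list) \<Rightarrow> bool" where
  "reduced_patterns A \<longleftrightarrow> (\<forall>i j. i \<noteq> j \<longrightarrow> \<not> sublist (A i) (A j))"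

definition exp_first_hit ::
    "'w measure \<Rightarrow> (nat \<Rightarrow> 'w \<Rightarrow> 'a) \<Rightarrow> ('m::finite \<Rightarrow> 'a list) \<Rightarrow> ennreal" where
  "exp_first_hit M \<xi> A = (\<integral>\<^sup>+ \<omega>. ennreal_of_enat (first_hit \<xi> A \<omega>) \<partial>M)"

definition cond_exp_first_hit ::
    "'w measure \<Rightarrow> (nat \<Rightarrow> 'w \<Rightarrow> 'a) \<Rightarrow> ('m::finite \<Rightarrow> 'a list) \<Rightarrow> 'm \<Rightarrow> ennreal" where
  "cond_exp_first_hit M \<xi> A i =
     (\<Sum>n. of_nat n * ennreal \<P>(\<omega> in M. first_hit \<xi> A \<omega> = enat n \<bar> wins \<xi> A i \<omega>))"

definition letter_prob :: "'w measure \<Rightarrow> (nat \<Rightarrow> 'w \<Rightarrow> 'a) \<Rightarrow> 'a \<Rightarrow> real" where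
  "letter_prob M \<xi> a = \<P>(\<omega> in M. \<xi> 1 \<omega> = a)"

definition word_prob :: "('a \<Rightarrow> real) \<Rightarrow> 'a list \<Rightarrow> real" where
  "word_prob p A = (\<Prod>a\<leftarrow>A. p a)"

definition last_letters :: "nat \<Rightarrow> 'a list \<Rightarrow> 'a list" where
  "last_letters k A = drop (length A - k) A"

(* corr_poly p A B is w_A^B: prefixes of A are compared with suffixes of B. *)
definition corr_poly :: "('a \<Rightarrow> real) \<Rightarrow> 'a list \<Rightarrow> 'a list \<Rightarrow> real \<Rightarrow> real" where
  "corr_poly p A B s =
     (\<Sum>k = 1..min (length A) (length B).
        of_bool (take k A = last_letters k B) *
        word_prob p (last_letters (length A - k) A) * s ^ (length A - k))"

definition corr_matrix ::
    "('a \<Rightarrow> real) \<Rightarrow> ('m::finite \<Rightarrow> 'a list) \<Rightarrow> real \<Rightarrow> real ^ 'm ^ 'm" where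
  "corr_matrix p A s = (\<chi> i j. corr_poly p (A i) (A j) s)"

definition corr_matrix_repl ::
    "('a \<Rightarrow> real) \<Rightarrow> ('m::finite \<Rightarrow> 'a list) \<Rightarrow> 'm \<Rightarrow> real \<Rightarrow> real ^ 'm ^ 'm" where
  "corr_matrix_repl p A j s =
     (\<chi> i k. if k = j then word_prob p (A i) * s ^ length (A i) else corr_matrix p A s $ i $ k)"

definition det_ratio ::
    "('a \<Rightarrow> real) \<Rightarrow> ('m::finite \<Rightarrow> 'a list) \<Rightarrow> 'm \<Rightarrow> real \<Rightarrow> real" where
  "det_ratio p A i s =
     det (corr_matrix_repl p A i s) / (\<Sum>j\<in>UNIV. det (corr_matrix_repl p A j s))"

(* Removes a possible removable singularity at 1. The other singularities of a rational
   function are isolated, so they do not affect its derivative at 1. *)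
definition extend_at_1 :: "(real \<Rightarrow> real) \<Rightarrow> real \<Rightarrow> real" where
  "extend_at_1 f = f(1 := Lim (at_left 1) f)"

end

theory Submission
  imports Defs
begin

text \<open>
  Write \<open>surv n\<close> for the probability that \<open>\<tau> > n\<close> and \<open>win j n\<close> for the probability that
  \<open>\<tau> = \<tau>\<^sub>j = n\<close>, and let \<open>surv_gf\<close> and \<open>win_gf j\<close> be their generating functions, abbreviated \<open>F\<close>
  and \<open>G\<^sub>j\<close> below. If the letters of \<open>A\<^sub>i\<close> are appended to a word of length \<open>n\<close> that
  contains no pattern, then some pattern occurs by time \<open>n + l\<^sub>i\<close>. Sorting these words by the first
  pattern \<open>A\<^sub>j\<close> to occur and by its time \<open>n + k\<close>, and using that the \<open>k\<close> letters of \<open>A\<^sub>i\<close> read so far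
  must be a suffix of \<open>A\<^sub>j\<close>, gives the renewal identity \<open>surv_times_pattern\<close>. Multiplied by
  \<open>s\<close> to the power \<open>n + l\<^sub>i\<close> and summed over \<open>n\<close>, it says that the matrix \<open>\<B>(s)\<close> maps the vector
  \<open>G(s)\<close> to \<open>F(s)\<close> times the vector with entries \<open>Pr(A\<^sub>i) s\<^bsup>l\<^sub>i\<^esup>\<close> (\<open>corr_matrix_mult_win_gf\<close>). By
  Cramer's rule the determinant with the \<open>j\<close>-th column replaced is \<open>G\<^sub>j(s) / F(s)\<close> times the
  determinant of \<open>\<B>(s)\<close>, so that the determinant ratio is \<open>G\<^sub>i\<close> divided by the sum of all \<open>G\<^sub>j\<close>,
  wherever \<open>\<B>(s)\<close> is nonsingular (\<open>det_ratio_eq\<close>).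

  The determinant of \<open>\<B>\<close> is a polynomial with value 1 at 0, because \<open>\<B>(0)\<close> is the identity for a
  reduced set of patterns; it therefore vanishes at finitely many points only, and a zero at 1 is
  exactly the removable singularity of the ratio. A pattern that wins with positive probability has
  positive word probability, and then the renewal identity bounds \<open>surv\<close> by a geometric sequence
  (\<open>surv_exponential_decay\<close>). Hence \<open>F\<close> and all \<open>G\<^sub>j\<close> converge beyond 1 and the ratio may be
  differentiated there.

  One step of the race gives that the sum of all \<open>G\<^sub>j(s)\<close> is \<open>1 - (1 - s) F(s)\<close>
  (\<open>win_gf_total\<close>), a function with value 1 and derivative \<open>F(1) = E\<tau>\<close> at 1. The quotient rule
  gives the derivative \<open>G\<^sub>i'(1) - G\<^sub>i(1) E\<tau>\<close>, where \<open>G\<^sub>i(1)\<close> is the probability that \<open>A\<^sub>i\<close> wins and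
  \<open>G\<^sub>i'(1)\<close> is the expectation of \<open>\<tau>\<close> on that event; division by \<open>G\<^sub>i(1)\<close> is the claim.
\<close>

section \<open>Words and their probabilities\<close>

lemma sublist_iff_suffix_or_butlast:
  "sublist ys xs \<longleftrightarrow> suffix ys xs \<or> sublist ys (butlast xs)"
proof (cases xs rule: rev_cases)
  case (snoc us a)
  then show ?thesis
    unfolding sublist_altdef by (auto simp: prefix_snoc)
qed auto

lemma last_letters_eq_iff_suffix:
  assumes "length u \<le> length B"
  shows "u = last_letters (length u) B \<longleftrightarrow> suffix u B"
  using assms by (auto simp: last_letters_def suffix_def) (metis append_take_drop_id)

lemma word_prob_append [simp]: "word_prob p (u @ v) = word_prob p u * word_prob p v"
  by (simp add: word_prob_def)

lemma word_prob_simps [simp]: "word_prob p [] = 1" "word_prob p (a # u) = p a * word_prob p u"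
  by (simp_all add: word_prob_def)

section \<open>Words free of patterns and the renewal identity\<close>

text \<open>
  The race reduces to weighted counting of finite words: a set of words of length \<open>n\<close> has as its
  weight the probability that the first \<open>n\<close> letters form one of them. Everything up to the
  probabilistic interpretation needs only these weights.
\<close>
locale pattern_race =
  fixes p :: "'a \<Rightarrow> real" and \<Omega> :: "'a set" and A :: "'m::finite \<Rightarrow> 'a list"
  assumes finite_alphabet: "finite \<Omega>"
    and prob_nonneg: "a \<in> \<Omega> \<Longrightarrow> 0 \<le> p a"
    and prob_sum: "sum p \<Omega> = 1"
    and nonempty: "A j \<noteq> []"
    and letters: "set (A j) \<subseteq> \<Omega>"
    and reduced: "reduced_patterns A"
begin

definition words :: "nat \<Rightarrow> 'a list set" where
  "words n = {w. set w \<subseteq> \<Omega> \<and> length w = n}"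

definition avoids :: "'a list \<Rightarrow> bool" where
  "avoids w \<longleftrightarrow> (\<forall>j. \<not> sublist (A j) w)"

definition avoiding :: "nat \<Rightarrow> 'a list set" where
  "avoiding n = {w \<in> words n. avoids w}"

text \<open>
  In a word of \<open>winning j n\<close> some pattern occurs, the first occurrence is complete only with the last
  letter, and it is an occurrence of \<open>A j\<close>: this is the event \<open>\<tau> = \<tau>\<^sub>j = n\<close>.
\<close>
definition winning :: "'m \<Rightarrow> nat \<Rightarrow> 'a list set" where
  "winning j n = {w \<in> words n. suffix (A j) w \<and> avoids (butlast w)}"

definition surv :: "nat \<Rightarrow> real" where "surv n = sum (word_prob p) (avoiding n)"
definition win :: "'m \<Rightarrow> nat \<Rightarrow> real" where "win j n = sum (word_prob p) (winning j n)"

lemma finite_words [simp]: "finite (words n)"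
  unfolding words_def using finite_lists_length_eq[OF finite_alphabet] by simp

lemma finite_avoiding [simp]: "finite (avoiding n)" and finite_winning [simp]: "finite (winning j n)"
  by (simp_all add: avoiding_def winning_def)

lemma word_prob_nonneg: "set w \<subseteq> \<Omega> \<Longrightarrow> 0 \<le> word_prob p w"
  by (induction w) (auto simp: prob_nonneg)

lemma prob_le_1: "a \<in> \<Omega> \<Longrightarrow> p a \<le> 1"
  using member_le_sum[of a \<Omega> p] finite_alphabet prob_sum prob_nonneg by auto

lemma word_prob_le_1: "set w \<subseteq> \<Omega> \<Longrightarrow> word_prob p w \<le> 1"
  by (induction w) (auto simp: prob_nonneg prob_le_1 word_prob_nonneg intro!: mult_le_one)

lemma sublist_pattern_eq: "sublist (A i) (A j) \<Longrightarrow> i = j"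
  using reduced by (auto simp: reduced_patterns_def)

text \<open>
  Of two patterns that end at the same position, the shorter is a suffix of the longer. So in a
  reduced set at most one pattern wins at any time.
\<close>
lemma suffix_pattern_unique:
  assumes "suffix (A i) w" "suffix (A j) w" shows "i = j"
  using suffix_same_cases[OF assms] sublist_pattern_eq by (metis suffix_imp_sublist)

lemma avoids_sublist: "avoids w \<Longrightarrow> sublist u w \<Longrightarrow> avoids u"
  unfolding avoids_def using sublist_order.order.trans by blast

lemma not_avoids_iff: "\<not> avoids w \<longleftrightarrow> (\<exists>j. suffix (A j) w) \<or> \<not> avoids (butlast w)"
  unfolding avoids_def using sublist_iff_suffix_or_butlast by blast

lemma avoids_Nil [simp]: "avoids []"
  using nonempty by (auto simp: avoids_def)

lemma winning_not_avoids: "w \<in> winning j n \<Longrightarrow> \<not> avoids w"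
  by (auto simp: winning_def avoids_def)

lemma surv_0: "surv 0 = 1"
proof -
  have "avoiding 0 = {[]}" by (auto simp: avoiding_def words_def)
  then show ?thesis by (simp add: surv_def)
qed

lemma surv_nonneg: "0 \<le> surv n" and win_nonneg: "0 \<le> win j n"
  by (auto simp: surv_def win_def avoiding_def winning_def words_def intro!: sum_nonneg word_prob_nonneg)

lemma win_early: "n < length (A j) \<Longrightarrow> win j n = 0"
proof -
  assume "n < length (A j)"
  then have "winning j n = {}" by (auto simp: winning_def words_def dest!: suffix_length_le)
  then show ?thesis by (simp add: win_def)
qed

lemma sum_word_prob_append:
  "sum (word_prob p) ((\<lambda>u. u @ v) ` S) = sum (word_prob p) S * word_prob p v"
  by (subst sum.reindex) (auto simp: inj_on_def sum_distrib_right)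

text \<open>
  One more letter after a pattern-free word either completes no pattern or decides the race at once.
\<close>
lemma one_more_letter:
  "(\<lambda>(w, a). w @ [a]) ` (avoiding n \<times> \<Omega>) = avoiding (Suc n) \<union> (\<Union>j. winning j (Suc n))" (is "?L = ?R")
proof
  show "?L \<subseteq> ?R"
  proof safe
    fix w a assume "w \<in> avoiding n" "a \<in> \<Omega>" "w @ [a] \<notin> (\<Union>j. winning j (Suc n))"
    then show "w @ [a] \<in> avoiding (Suc n)"
      using not_avoids_iff[of "w @ [a]"] by (auto simp: avoiding_def winning_def words_def)
  qed
  show "?R \<subseteq> ?L"
  proof
    fix x assume x: "x \<in> ?R"
    then have x': "x \<in> words (Suc n)" "avoids (butlast x)"
      using not_avoids_iff by (auto simp: avoiding_def winning_def)
    then have "x \<noteq> []" by (auto simp: words_def)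
    then obtain w a where "x = w @ [a]" by (metis rev_exhaust)
    with x' show "x \<in> ?L" by (auto simp: avoiding_def words_def)
  qed
qed

lemma surv_Suc: "surv n = surv (Suc n) + (\<Sum>j\<in>UNIV. win j (Suc n))"
proof -
  have "sum (word_prob p) ((\<lambda>(w, a). w @ [a]) ` (avoiding n \<times> \<Omega>)) 
      = (\<Sum>(w, a)\<in>avoiding n \<times> \<Omega>. word_prob p w * p a)"
    by (subst sum.reindex) (auto simp: inj_on_def intro!: sum.cong)
  also have "\<dots> = surv n * sum p \<Omega>"
    by (simp add: surv_def sum_product sum.cartesian_product)
  finally have "surv n = sum (word_prob p) (avoiding (Suc n) \<union> (\<Union>j. winning j (Suc n)))"
    by (simp add: prob_sum one_more_letter)
  also have "\<dots> = surv (Suc n) + sum (word_prob p) (\<Union>j. winning j (Suc n))"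
    unfolding surv_def by (intro sum.union_disjoint) (auto simp: avoiding_def dest: winning_not_avoids)
  also have "sum (word_prob p) (\<Union>j. winning j (Suc n)) = (\<Sum>j\<in>UNIV. win j (Suc n))"
    unfolding win_def
    by (intro sum.UNION_disjoint) (auto simp: winning_def dest: suffix_pattern_unique)
  finally show ?thesis .
qed

text \<open>
  These pairs index the terms of the \<open>i\<close>-th row of the correlation matrix whose words agree: a
  pair \<open>(j, k)\<close> stands for an occurrence of \<open>A i\<close> that starts with the last \<open>k\<close> letters of \<open>A j\<close>.
\<close>
definition overlaps :: "'m \<Rightarrow> ('m \<times> nat) set" where
  "overlaps i = (SIGMA j:UNIV. {k\<in>{1..min (length (A i)) (length (A j))}.
      take k (A i) = last_letters k (A j)})"

lemma finite_overlaps [simp]: "finite (overlaps i)"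
  unfolding overlaps_def by (intro finite_SigmaI) auto

text \<open>
  Cut \<open>w @ A i\<close>, with \<open>w\<close> free of patterns, at the moment when the race is decided. The cut lies
  inside \<open>A i\<close>, after \<open>k\<close> of its letters. The winner \<open>A j\<close> is at least \<open>k\<close> letters long: otherwise
  it would be a block inside \<open>A i\<close>, which a reduced set excludes for \<open>j \<noteq> i\<close>, while \<open>k\<close> never
  exceeds the length of \<open>A i\<close>. Hence \<open>A j\<close> ends with the first \<open>k\<close> letters of \<open>A i\<close>.
\<close>
lemma pattern_after_avoiding:
  "(\<lambda>w. w @ A i) ` avoiding n = (\<Union>(j, k)\<in>overlaps i. (\<lambda>u. u @ drop k (A i)) ` winning j (n + k))"
    (is "?L = ?R")
proof
  show "?L \<subseteq> ?R"
  proof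
    fix x assume "x \<in> ?L"
    then obtain w where w: "w \<in> words n" "avoids w" and x: "x = w @ A i" by (auto simp: avoiding_def)
    have lw: "length w = n" using w by (auto simp: words_def)
    \<comment> \<open>The time at which the race is decided.\<close>
    define m where "m = (LEAST m. \<not> avoids (take m x))"
    have "\<not> avoids (take (length x) x)" by (auto simp: x avoids_def)
    then have bad: "\<not> avoids (take m x)" and mle: "m \<le> length x"
      unfolding m_def by (rule LeastI, rule Least_le)
    have good: "avoids (take m' x)" if "m' < m" for m' 
      using not_less_Least that unfolding m_def by blast
    have "m > n"
    proof (rule ccontr)
      assume "\<not> m > n"
      then have "take m x = take m w" using x lw by simp
      then show False using bad avoids_sublist[OF w(2), of "take m w"] by simp
    qed
    then obtain k where k: "m = n + k" "k \<ge> 1" using less_imp_add_positive[of n m] by auto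
    have kle: "k \<le> length (A i)" using mle k lw x by simp
    define u where "u = take m x"
    have u: "u = w @ take k (A i)" by (simp add: u_def k x lw)
    have "butlast u = take (m - 1) x"
      using mle by (simp add: u_def butlast_take)
    then have bl: "avoids (butlast u)" using good[of "m - 1"] k by simp
    then obtain j where j: "suffix (A j) u" using bad not_avoids_iff[of u] u_def by blast
    have uw: "u \<in> words (n + k)"
      using w letters[of i] kle set_take_subset[of k "A i"] by (auto simp: u words_def)
    have ts: "suffix (take k (A i)) u" by (simp add: u suffixI)
    have kj: "k \<le> length (A j)"
    proof (rule ccontr)
      assume "\<not> k \<le> length (A j)"
      then have "suffix (A j) (take k (A i))"
        using suffix_length_suffix[OF j ts] kle by simp
      then have "sublist (A j) (A i)"
        by (metis sublist_order.order.trans sublist_take suffix_imp_sublist)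
      then have "j = i" by (rule sublist_pattern_eq)
      then show False using kle \<open>\<not> k \<le> length (A j)\<close> by simp
    qed
    have "suffix (take k (A i)) (A j)"
      using suffix_length_suffix[OF ts j] kj by simp
    then have "(j, k) \<in> overlaps i"
      using last_letters_eq_iff_suffix[of "take k (A i)" "A j"] kle kj k
      by (auto simp: overlaps_def min_def)
    moreover have "u \<in> winning j (n + k)" using uw j bl by (simp add: winning_def)
    moreover have "x = u @ drop k (A i)" by (simp add: u x)
    ultimately show "x \<in> ?R" by blast
  qed
  show "?R \<subseteq> ?L"
  proof safe
    fix j k u assume jk: "(j, k) \<in> overlaps i" and "u \<in> winning j (n + k)"
    then have u: "u \<in> words (n + k)" "suffix (A j) u" "avoids (butlast u)" by (auto simp: winning_def)
    have k: "1 \<le> k" "k \<le> length (A i)" "k \<le> length (A j)" 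
      and "take k (A i) = last_letters k (A j)"
      using jk by (auto simp: overlaps_def)
    then have "suffix (take k (A i)) (A j)"
      using last_letters_eq_iff_suffix[of "take k (A i)" "A j"] by (metis length_take min.absorb2)
    then have "suffix (take k (A i)) u" using u(2) suffix_order.trans by blast
    then obtain w where w: "u = w @ take k (A i)" by (auto simp: suffix_def)
    have "take k (A i) \<noteq> []" using k nonempty by auto
    then have "avoids w" using u(3) avoids_sublist[of "butlast u" w] by (simp add: w butlast_append)
    then have "w \<in> avoiding n" using u(1) k by (auto simp: w avoiding_def words_def)
    then show "u @ drop k (A i) \<in> ?L" by (auto simp: w)
  qed
qed

text \<open>
  The race is decided only once along a sequence of letters, so the decompositions in
  \<open>pattern_after_avoiding\<close> are unique.
\<close>
lemma prefix_winning_eq: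
  assumes "u \<in> winning j m" "u' \<in> winning j' m'" "prefix u u'"
  shows "u = u'" "j = j'"
proof -
  show "u = u'"
  proof (rule ccontr)
    assume "u \<noteq> u'"
    then have "prefix u (butlast u')"
      using assms(3) by (cases u' rule: rev_cases) (auto simp: prefix_snoc)
    then have "avoids u" using assms(2) avoids_sublist by (auto simp: winning_def)
    then show False using winning_not_avoids assms(1) by blast
  qed
  then show "j = j'" using assms suffix_pattern_unique by (auto simp: winning_def)
qed

text \<open>
  The renewal identity: both sides are the probability that no pattern has occurred by time \<open>n\<close> and
  that the next letters spell \<open>A i\<close>. On the right the letters after the decision, \<open>drop k (A i)\<close>, are
  independent of it.
\<close>
lemma surv_times_pattern:
  "surv n * word_prob p (A i) = (\<Sum>(j, k)\<in>overlaps i. win j (n + k) * word_prob p (drop k (A i)))"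
proof -
  have disj: "j = j' \<and> k = k'" 
    if "u \<in> winning j (n + k)" "u' \<in> winning j' (n + k')" "u @ drop k (A i) = u' @ drop k' (A i)" 
    for j j' k k' u u'
  proof -
    have "prefix u u' \<or> prefix u' u"
      using that(3) by (metis prefixI prefix_same_cases)
    then have "u = u' \<and> j = j'" using prefix_winning_eq that by metis
    moreover from this that have "k = k'" by (auto simp: winning_def words_def)
    ultimately show ?thesis by simp
  qed
  have "surv n * word_prob p (A i) = sum (word_prob p) ((\<lambda>w. w @ A i) ` avoiding n)"
    by (simp add: sum_word_prob_append surv_def)
  also have "\<dots> = (\<Sum>(j, k)\<in>overlaps i. 
      sum (word_prob p) ((\<lambda>u. u @ drop k (A i)) ` winning j (n + k)))"
    unfolding pattern_after_avoiding
    by (subst sum.UNION_disjoint) (auto simp: case_prod_unfold dest: disj)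
  finally show ?thesis by (simp add: sum_word_prob_append win_def)
qed

section \<open>Geometric decay of the survival probabilities\<close>

lemma surv_telescope: "surv n = surv (n + l) + (\<Sum>j\<in>UNIV. \<Sum>k=1..l. win j (n + k))"
proof (induction l)
  case (Suc l)
  have "surv (n + l) = surv (n + Suc l) + (\<Sum>j\<in>UNIV. win j (n + Suc l))"
    using surv_Suc[of "n + l"] by simp
  then show ?case using Suc by (simp add: sum.distrib)
qed simp

text \<open>
  Spelling out \<open>A i\<close> ends the race, so during any \<open>length (A i)\<close> letters an undecided race is
  decided with probability at least that of \<open>A i\<close>.
\<close>
lemma surv_decay_step: "surv (n + length (A i)) \<le> (1 - word_prob p (A i)) * surv n"
proof -
  have "surv n * word_prob p (A i) = (\<Sum>(j, k)\<in>overlaps i. win j (n + k) * word_prob p (drop k (A i)))"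
    by (rule surv_times_pattern)
  also have "\<dots> \<le> (\<Sum>(j, k)\<in>overlaps i. win j (n + k))"
  proof (rule sum_mono, simp only: split_paired_all prod.case)
    fix j k
    have "set (drop k (A i)) \<subseteq> \<Omega>" using letters[of i] set_drop_subset[of k "A i"] by simp
    then show "win j (n + k) * word_prob p (drop k (A i)) \<le> win j (n + k)"
      using win_nonneg by (intro mult_right_le_one_le word_prob_le_1 word_prob_nonneg) auto
  qed
  also have "\<dots> \<le> (\<Sum>(j, k)\<in>UNIV \<times> {1..length (A i)}. win j (n + k))"
    by (intro sum_mono2) (auto simp: overlaps_def win_nonneg)
  also have "\<dots> = surv n - surv (n + length (A i))"
    using surv_telescope[of n "length (A i)"] by (simp add: sum.cartesian_product)
  finally show ?thesis by (simp add: algebra_simps)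
qed

lemma surv_exponential_decay:
  assumes "0 < word_prob p (A i)"
  obtains C r where "0 < r" "r < 1" "\<And>n. surv n \<le> C * r ^ n"
proof -
  define l where "l = length (A i)"
  \<comment> \<open>Halving the word probability keeps the factor positive, so that its root is a ratio in (0, 1).\<close>
  define c where "c = 1 - word_prob p (A i) / 2"
  define r where "r = root l c"
  have "0 < l" using nonempty by (auto simp: l_def)
  have c: "0 < c" "c < 1" using assms word_prob_le_1[OF letters[of i]] by (auto simp: c_def)
  have r: "0 < r" "r < 1" "r ^ l = c" using c \<open>0 < l\<close> by (auto simp: r_def)
  have step: "surv (n + l) \<le> c * surv n" for n
  proof -
    have "surv (n + l) \<le> (1 - word_prob p (A i)) * surv n" unfolding l_def by (rule surv_decay_step)
    also have "\<dots> \<le> c * surv n" using assms surv_nonneg by (intro mult_right_mono) (auto simp: c_def)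
    finally show ?thesis .
  qed
  \<comment> \<open>The constant compensates the incomplete block: for \<open>n < l\<close> the power \<open>r ^ n\<close> is at least \<open>c\<close>.\<close>
  have "surv n \<le> 1 / c * r ^ n" for n
  proof (induction n rule: less_induct)
    case (less n)
    show ?case
    proof (cases "n < l")
      case True
      have "0 \<le> (\<Sum>j\<in>UNIV. \<Sum>k=1..n. win j (0 + k))"
        by (intro sum_nonneg win_nonneg)
      then have "surv n \<le> 1" using surv_telescope[of 0 n] by (simp add: surv_0)
      also have "1 \<le> 1 / c * r ^ n"
        using True r c power_decreasing[of n l r] by (simp add: field_simps)
      finally show ?thesis .
    next
      case False
      then obtain m where m: "n = m + l" by (metis add.commute le_iff_add not_less)
      have "surv n \<le> c * surv m" using step m by simp
      also have "\<dots> \<le> c * (1 / c * r ^ m)"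
        using less[of m] m \<open>0 < l\<close> c by (intro mult_left_mono) auto
      also have "\<dots> = 1 / c * r ^ n" using c r by (simp add: m power_add)
      finally show ?thesis .
    qed
  qed
  with r show ?thesis using that by blast
qed

section \<open>Generating functions and the correlation matrix\<close>

definition surv_gf :: "real \<Rightarrow> real" where "surv_gf s = (\<Sum>n. surv n * s ^ n)"
definition win_gf :: "'m \<Rightarrow> real \<Rightarrow> real" where "win_gf j s = (\<Sum>n. win j n * s ^ n)"

lemma win_Suc_le: "win j (Suc n) \<le> surv n"
proof -
  have "win j (Suc n) \<le> (\<Sum>j\<in>UNIV. win j (Suc n))"
    by (rule member_le_sum) (auto simp: win_nonneg)
  then show ?thesis using surv_Suc[of n] surv_nonneg[of "Suc n"] by simp
qed

lemma summable_beyond_1: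
  assumes "0 < word_prob p (A i)"
  obtains K where "1 < K" "summable (\<lambda>n. surv n * K ^ n)" "\<And>j. summable (\<lambda>n. win j n * K ^ n)"
proof -
  obtain C r where r: "0 < r" "r < 1" "\<And>n. surv n \<le> C * r ^ n"
    using surv_exponential_decay[OF assms] by blast
  \<comment> \<open>The harmonic mean of 1 and 1 / r: a point strictly between them.\<close>
  define K where "K = 2 / (1 + r)"
  have K: "1 < K" "r * K < 1" using r by (auto simp: K_def field_simps)
  have sum_surv: "summable (\<lambda>n. surv n * K ^ n)"
  proof (rule summable_comparison_test')
    show "summable (\<lambda>n. C * (r * K) ^ n)"
      using K r by (intro summable_mult summable_geometric) auto
    show "norm (surv n * K ^ n) \<le> C * (r * K) ^ n" for n
      using mult_right_mono[OF r(3), of "K ^ n" n] K surv_nonneg[of n]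
      by (simp add: power_mult_distrib mult_ac)
  qed
  have "summable (\<lambda>n. win j n * K ^ n)" for j
  proof (subst summable_Suc_iff[symmetric], rule summable_comparison_test')
    show "summable (\<lambda>n. K * (surv n * K ^ n))" using sum_surv by (rule summable_mult)
    show "norm (win j (Suc n) * K ^ Suc n) \<le> K * (surv n * K ^ n)" for n
      using mult_right_mono[OF win_Suc_le, of "K ^ Suc n" j n] K win_nonneg[of j "Suc n"]
      by (simp add: mult_ac)
  qed
  with K sum_surv show ?thesis using that by blast
qed

text \<open>
  Summation by parts: the probability of a decision at time \<open>n + 1\<close> is \<open>surv n - surv (n + 1)\<close>.
\<close>
lemma win_gf_total:
  assumes "summable (\<lambda>n. surv n * s ^ n)" "\<And>j. summable (\<lambda>n. win j n * s ^ n)"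
  shows "(\<Sum>j\<in>UNIV. win_gf j s) = 1 - (1 - s) * surv_gf s"
proof -
  have win0: "win j 0 = 0" for j using nonempty by (intro win_early) auto
  have sq: "(\<lambda>n. surv (Suc n) * s ^ Suc n) sums (surv_gf s - 1)"
    using summable_sums[OF summable_ignore_initial_segment[OF assms(1), where k = 1]]
      suminf_split_head[OF assms(1)] by (simp add: surv_gf_def surv_0)
  have sg: "(\<lambda>n. win j (Suc n) * s ^ Suc n) sums win_gf j s" for j
    using summable_sums[OF summable_ignore_initial_segment[OF assms(2), where k = 1]]
      suminf_split_head[OF assms(2)] by (simp add: win_gf_def win0)
  have "(\<lambda>n. surv (Suc n) * s ^ Suc n + (\<Sum>j\<in>UNIV. win j (Suc n) * s ^ Suc n))
      sums (surv_gf s - 1 + (\<Sum>j\<in>UNIV. win_gf j s))"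
    by (intro sums_add sq sums_sum sg)
  moreover have "surv (Suc n) * s ^ Suc n + (\<Sum>j\<in>UNIV. win j (Suc n) * s ^ Suc n) = s * (surv n * s ^ n)" for n
    by (subst (2) surv_Suc) (simp add: sum_distrib_left sum_distrib_right algebra_simps)
  moreover have "(\<lambda>n. s * (surv n * s ^ n)) sums (s * surv_gf s)"
    unfolding surv_gf_def using assms(1) by (intro sums_mult summable_sums)
  ultimately have "surv_gf s - 1 + (\<Sum>j\<in>UNIV. win_gf j s) = s * surv_gf s"
    by (simp add: sums_unique2)
  then show ?thesis by (simp add: algebra_simps)
qed

lemma corr_poly_overlaps:
  "(\<Sum>j\<in>UNIV. corr_poly p (A i) (A j) s * c j) =
    (\<Sum>(j, k)\<in>overlaps i. word_prob p (drop k (A i)) * s ^ (length (A i) - k) * c j)"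
proof -
  have "corr_poly p (A i) (A j) s * c j = (\<Sum>k\<in>{k\<in>{1..min (length (A i)) (length (A j))}.
      take k (A i) = last_letters k (A j)}. word_prob p (drop k (A i)) * s ^ (length (A i) - k) * c j)" for j
    unfolding corr_poly_def sum.inter_filter[OF finite_atLeastAtMost] sum_distrib_right
    by (intro sum.cong) (auto simp: last_letters_def)
  then show ?thesis unfolding overlaps_def by (simp add: sum.Sigma)
qed

text \<open>
  The renewal identity turned into generating functions. Shifting the series of \<open>win j\<close> by \<open>k\<close>
  loses nothing, since \<open>A j\<close> has at least \<open>k\<close> letters and cannot occur before time \<open>k\<close>.
\<close>
lemma corr_matrix_mult_win_gf:
  assumes "summable (\<lambda>n. surv n * s ^ n)" "\<And>j. summable (\<lambda>n. win j n * s ^ n)"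
  shows "(\<Sum>j\<in>UNIV. corr_poly p (A i) (A j) s * win_gf j s)
    = word_prob p (A i) * s ^ length (A i) * surv_gf s"
proof -
  have sg: "(\<lambda>n. win j (n + k) * s ^ (n + k)) sums win_gf j s" if "(j, k) \<in> overlaps i" for j k
  proof -
    have "(\<Sum>m<k. win j m * s ^ m) = 0"
      using that by (intro sum.neutral ballI) (auto simp: overlaps_def win_early)
    then show ?thesis
      using suminf_split_initial_segment[OF assms(2), of j k]
        summable_sums[OF summable_ignore_initial_segment[OF assms(2)], of j k]
      by (simp add: win_gf_def)
  qed
  have "(\<lambda>n. word_prob p (A i) * s ^ length (A i) * (surv n * s ^ n)) sums
      (word_prob p (A i) * s ^ length (A i) * surv_gf s)"
    unfolding surv_gf_def using assms(1) by (intro sums_mult summable_sums)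
  moreover have "(\<lambda>n. \<Sum>(j, k)\<in>overlaps i. word_prob p (drop k (A i)) * s ^ (length (A i) - k) *
      (win j (n + k) * s ^ (n + k))) sums (\<Sum>j\<in>UNIV. corr_poly p (A i) (A j) s * win_gf j s)"
    unfolding corr_poly_overlaps case_prod_unfold
    by (intro sums_sum sums_mult sg) auto
  moreover have "(\<Sum>(j, k)\<in>overlaps i. word_prob p (drop k (A i)) * s ^ (length (A i) - k) *
      (win j (n + k) * s ^ (n + k))) = word_prob p (A i) * s ^ length (A i) * (surv n * s ^ n)" for n
  proof -
    have "(\<Sum>(j, k)\<in>overlaps i. word_prob p (drop k (A i)) * s ^ (length (A i) - k) *
      (win j (n + k) * s ^ (n + k))) = 
      (\<Sum>(j, k)\<in>overlaps i. win j (n + k) * word_prob p (drop k (A i)) * s ^ (length (A i) + n))"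
    proof (intro sum.cong refl, clarify)
      fix j k assume "(j, k) \<in> overlaps i"
      then have "s ^ (length (A i) - k) * s ^ (n + k) = s ^ (length (A i) + n)"
        by (subst power_add[symmetric]) (auto simp: overlaps_def)
      then show "word_prob p (drop k (A i)) * s ^ (length (A i) - k) * (win j (n + k) * s ^ (n + k)) =
          win j (n + k) * word_prob p (drop k (A i)) * s ^ (length (A i) + n)"
        by (metis mult.assoc mult.commute)
    qed
    also have "\<dots> = surv n * word_prob p (A i) * s ^ (length (A i) + n)"
      unfolding surv_times_pattern sum_distrib_right by (simp add: case_prod_unfold)
    finally show ?thesis by (simp add: power_add mult_ac)
  qed
  ultimately show ?thesis by (simp add: sums_unique2)
qed

lemma det_corr_matrix_repl:
  assumes "summable (\<lambda>n. surv n * s ^ n)" "\<And>j. summable (\<lambda>n. win j n * s ^ n)" "surv_gf s \<noteq> 0"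
  shows "det (corr_matrix_repl p A j s) = win_gf j s / surv_gf s * det (corr_matrix p A s)"
proof -
  define x :: "real ^ 'm" where "x = (\<chi> k. win_gf k s / surv_gf s)"
  have "(corr_matrix p A s *v x) $ i = word_prob p (A i) * s ^ length (A i)" for i
    using corr_matrix_mult_win_gf[OF assms(1,2), of i] assms(3)
    by (simp add: matrix_vector_mult_def corr_matrix_def x_def sum_divide_distrib[symmetric])
  then have "corr_matrix_repl p A j s =
      (\<chi> i k. if k = j then (corr_matrix p A s *v x) $ i else corr_matrix p A s $ i $ k)"
    by (simp add: corr_matrix_repl_def vec_eq_iff)
  then show ?thesis by (simp add: cramer_lemma x_def)
qed

text \<open>
  The common factor \<open>det (corr_matrix p A s) / surv_gf s\<close> of all replaced determinants cancels. It
  must be nonzero: where the correlation matrix is singular, so are all the replaced ones, and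
  \<open>det_ratio\<close> has the default value 0.
\<close>
lemma det_ratio_eq:
  assumes "summable (\<lambda>n. surv n * s ^ n)" "\<And>j. summable (\<lambda>n. win j n * s ^ n)"
    and "surv_gf s \<noteq> 0" "det (corr_matrix p A s) \<noteq> 0"
  shows "det_ratio p A i s = win_gf i s / (1 - (1 - s) * surv_gf s)"
proof -
  let ?d = "det (corr_matrix p A s) / surv_gf s"
  have repl: "det (corr_matrix_repl p A j s) = win_gf j s * ?d" for j
    by (simp add: det_corr_matrix_repl[OF assms(1-3)])
  have "det_ratio p A i s = (win_gf i s * ?d) / ((\<Sum>j\<in>UNIV. win_gf j s) * ?d)"
    by (simp add: det_ratio_def repl sum_distrib_right
        del: times_divide_eq_left times_divide_eq_right)
  also have "\<dots> = win_gf i s / (\<Sum>j\<in>UNIV. win_gf j s)" using assms(3,4) by simp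
  finally show ?thesis by (simp add: win_gf_total[OF assms(1,2)])
qed

text \<open>
  Only the term \<open>k = length (A i)\<close> is constant. It tests whether the whole of \<open>A i\<close> is a suffix of
  \<open>A j\<close>, which in a reduced set happens for \<open>i = j\<close> only.
\<close>
lemma corr_poly_0: "corr_poly p (A i) (A j) 0 = of_bool (i = j)"
proof -
  have "corr_poly p (A i) (A j) 0 = (\<Sum>k = 1..min (length (A i)) (length (A j)).
      if k = length (A i) then of_bool (A i = last_letters (length (A i)) (A j)) else 0)"
    unfolding corr_poly_def by (intro sum.cong) (auto simp: last_letters_def)
  also have "\<dots> = of_bool (length (A i) \<le> length (A j) \<and> suffix (A i) (A j))"
    using nonempty[of i] last_letters_eq_iff_suffix[of "A i" "A j"] 
    by (auto simp: Suc_le_eq)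
  also have "\<dots> = of_bool (i = j)"
    using sublist_pattern_eq[of i j] suffix_imp_sublist[of "A i" "A j"] by auto
  finally show ?thesis .
qed

text \<open>
  The determinant is a polynomial in \<open>s\<close> with value 1 at \<open>s = 0\<close>, hence has finitely many zeros.
\<close>
lemma det_corr_matrix_nonzero: "\<forall>\<^sub>F s in at c. det (corr_matrix p A s) \<noteq> 0"
proof -
  \<comment> \<open>The correlation polynomials as formal polynomials.\<close>
  define Q where "Q i j = (\<Sum>k = 1..min (length (A i)) (length (A j)).
        monom (of_bool (take k (A i) = last_letters k (A j)) *
        word_prob p (last_letters (length (A i) - k) (A i))) (length (A i) - k))" for i j
  have Q: "poly (Q i j) s = corr_poly p (A i) (A j) s" for i j s
    by (simp add: Q_def corr_poly_def poly_sum poly_monom)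
  have D: "poly (det (\<chi> i j. Q i j)) s = det (corr_matrix p A s)" for s
    by (simp add: det_def poly_sum poly_prod Q corr_matrix_def)
  have "corr_matrix p A 0 = mat 1"
    by (simp add: corr_matrix_def corr_poly_0 mat_def vec_eq_iff)
  then have "poly (det (\<chi> i j. Q i j)) 0 = 1" by (simp add: D)
  then have "det (\<chi> i j. Q i j) \<noteq> 0" by auto
  then have "finite {s. det (corr_matrix p A s) = 0}"
    using poly_roots_finite by (simp add: D[symmetric])
  then have "\<not> c islimpt {s. det (corr_matrix p A s) = 0}" by (rule islimpt_finite)
  then show ?thesis by (simp add: islimpt_iff_eventually)
qed

text \<open>
  Near 1 the determinant ratio agrees with a quotient of power series that is smooth at 1, except
  possibly at 1 itself, where \<open>extend_at_1\<close> supplies the missing value by continuity.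
\<close>
lemma det_ratio_deriv:
  assumes "0 < word_prob p (A i)"
  shows "(extend_at_1 (det_ratio p A i) has_field_derivative
    (\<Sum>n. diffs (win i) n) - win_gf i 1 * surv_gf 1) (at 1)"
proof -
  obtain K where K: "1 < K" and sK: "summable (\<lambda>n. surv n * K ^ n)" "\<And>j. summable (\<lambda>n. win j n * K ^ n)"
    using summable_beyond_1[OF assms] by blast
  have sq: "summable (\<lambda>n. surv n * s ^ n)" and sg: "summable (\<lambda>n. win j n * s ^ n)"
    if "\<bar>s\<bar> < K" for s j
    using that powser_inside[OF sK(1), of s] powser_inside[OF sK(2), of s j] by auto
  define H where "H s = win_gf i s / (1 - (1 - s) * surv_gf s)" for s
  have dF: "(surv_gf has_field_derivative (\<Sum>n. diffs surv n)) (at 1)"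
    using termdiffs_strong[OF sK(1), of 1] K unfolding surv_gf_def by simp
  have dG: "(win_gf i has_field_derivative (\<Sum>n. diffs (win i) n)) (at 1)"
    using termdiffs_strong[OF sK(2), of 1] K unfolding win_gf_def by simp
  have dH: "(H has_field_derivative (\<Sum>n. diffs (win i) n) - win_gf i 1 * surv_gf 1) (at 1)"
    unfolding H_def by (rule derivative_eq_intros dF dG refl | simp)+
  have F1: "surv_gf 1 \<noteq> 0"
  proof -
    have "1 \<le> surv_gf 1"
      using sum_le_suminf[OF sq[of 1], of "{0}"] K surv_nonneg by (simp add: surv_gf_def surv_0)
    then show ?thesis by simp
  qed
  have "\<forall>\<^sub>F s in at 1. surv_gf s \<noteq> 0"
    using tendsto_imp_eventually_ne[OF DERIV_isCont[OF dF, unfolded isCont_def] F1] .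
  moreover have "\<forall>\<^sub>F s in at 1. \<bar>s\<bar> < K"
    using K by (intro order_tendstoD(2)[where y = "\<bar>1\<bar>"] tendsto_intros) auto
  ultimately have eq: "\<forall>\<^sub>F s in at 1. det_ratio p A i s = H s"
    using det_corr_matrix_nonzero[of 1]
    by eventually_elim (simp add: H_def det_ratio_eq sq sg)
  have "(H \<longlongrightarrow> H 1) (at 1)" using DERIV_isCont[OF dH] by (simp add: isCont_def)
  then have "(det_ratio p A i \<longlongrightarrow> H 1) (at 1)" using eq by (simp add: tendsto_cong)
  then have "(det_ratio p A i \<longlongrightarrow> H 1) (at_left 1)" by (simp add: filterlim_at_split)
  then have "Lim (at_left 1) (det_ratio p A i) = H 1" by (intro tendsto_Lim) auto
  then have "\<forall>\<^sub>F s in nhds 1. extend_at_1 (det_ratio p A i) s = H s"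
    using eq by (simp add: eventually_at_filter extend_at_1_def)
  from DERIV_cong_ev[OF refl this refl] dH show ?thesis by blast
qed

end

section \<open>Hitting times of a letter sequence\<close>

definition prefix_word :: "(nat \<Rightarrow> 'a) \<Rightarrow> nat \<Rightarrow> 'a list" where
  "prefix_word X n = map X [1..<Suc n]"

lemma length_prefix_word [simp]: "length (prefix_word X n) = n"
  by (simp add: prefix_word_def)

lemma prefix_word_0 [simp]: "prefix_word X 0 = []"
  by (simp add: prefix_word_def)

lemma butlast_prefix_word_Suc [simp]: "butlast (prefix_word X (Suc n)) = prefix_word X n"
  by (simp add: prefix_word_def)

lemma prefix_word_eq_iff: "prefix_word X n = w \<longleftrightarrow> length w = n \<and> (\<forall>k<n. X (Suc k) = w ! k)"
  by (auto simp: prefix_word_def list_eq_iff_nth_eq simp del: upt_Suc)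

lemma occurs_at_iff_suffix: "occurs_at X B n \<longleftrightarrow> suffix B (prefix_word X n)"
proof -
  have *: "drop (n - length B) (prefix_word X n) = map X [n - length B + 1..<n + 1]"
    by (simp add: prefix_word_def drop_map)
  show ?thesis
  proof
    assume "occurs_at X B n"
    then have "B = drop (n - length B) (prefix_word X n)" by (simp add: occurs_at_def *)
    then show "suffix B (prefix_word X n)" by (metis suffix_drop)
  next
    assume "suffix B (prefix_word X n)"
    then obtain u where u: "prefix_word X n = u @ B" by (auto simp: suffix_def)
    then have "length u + length B = n" by (metis length_append length_prefix_word)
    then have "length B \<le> n" "drop (n - length B) (prefix_word X n) = B" using u by auto
    then show "occurs_at X B n" by (simp add: occurs_at_def *)
  qed
qed

lemma sublist_prefix_word:
  assumes "B \<noteq> []"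
  shows "sublist B (prefix_word X n) \<longleftrightarrow> (\<exists>m\<le>n. occurs_at X B m)"
proof (induction n)
  case 0
  then show ?case using assms by (auto simp: occurs_at_def)
next
  case (Suc n)
  then show ?case
    using sublist_iff_suffix_or_butlast[of B "prefix_word X (Suc n)"]
    by (auto simp: occurs_at_iff_suffix[symmetric] le_Suc_eq)
qed

lemma less_hit_time_iff:
  assumes "B \<noteq> []"
  shows "enat n < hit_time \<xi> B \<omega> \<longleftrightarrow> \<not> sublist B (prefix_word (\<lambda>k. \<xi> k \<omega>) n)"
proof -
  have "enat n < hit_time \<xi> B \<omega> \<longleftrightarrow> enat (Suc n) \<le> hit_time \<xi> B \<omega>" by (simp add: Suc_ile_eq)
  also have "\<dots> \<longleftrightarrow> (\<forall>m. occurs_at (\<lambda>k. \<xi> k \<omega>) B m \<longrightarrow> Suc n \<le> m)"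
    by (auto simp: hit_time_def le_INF_iff)
  finally show ?thesis unfolding sublist_prefix_word[OF assms] by (auto simp: not_le Suc_le_eq)
qed

lemma enat_eq_Suc_iff: "x = enat (Suc n) \<longleftrightarrow> enat n < x \<and> \<not> enat (Suc n) < x"
  by (cases x) auto

section \<open>The race of patterns in independent letters\<close>

locale iid_pattern_race = prob_space M for M :: "'w measure" +
  fixes \<Omega> :: "'a set" and \<xi> :: "nat \<Rightarrow> 'w \<Rightarrow> 'a" and A :: "'m::finite \<Rightarrow> 'a list"
  assumes finite_letters: "finite \<Omega>"
    and indep: "indep_vars (\<lambda>_. count_space \<Omega>) \<xi> {1..}"
    and ident: "n \<ge> 1 \<Longrightarrow> distr M (count_space \<Omega>) (\<xi> n) = distr M (count_space \<Omega>) (\<xi> 1)"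
    and patterns_nonempty: "A j \<noteq> []"
    and patterns_letters: "set (A j) \<subseteq> \<Omega>"
    and patterns_reduced: "reduced_patterns A"
begin

abbreviation p :: "'a \<Rightarrow> real" where "p \<equiv> letter_prob M \<xi>"

abbreviation outcome :: "nat \<Rightarrow> 'w \<Rightarrow> 'a list" where
  "outcome n \<omega> \<equiv> prefix_word (\<lambda>k. \<xi> k \<omega>) n"

lemma measurable_letter: "n \<ge> 1 \<Longrightarrow> \<xi> n \<in> measurable M (count_space \<Omega>)"
  using indep by (auto simp: indep_vars_def)

lemma letter_in_alphabet: "\<omega> \<in> space M \<Longrightarrow> n \<ge> 1 \<Longrightarrow> \<xi> n \<omega> \<in> \<Omega>"
  using measurable_space[OF measurable_letter] by simp

lemma prob_letter:
  assumes "n \<ge> 1" "a \<in> \<Omega>"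
  shows "prob (\<xi> n -` {a} \<inter> space M) = p a"
proof -
  have "prob (\<xi> n -` {a} \<inter> space M) = measure (distr M (count_space \<Omega>) (\<xi> n)) {a}"
    using assms measurable_letter by (simp add: measure_distr)
  also have "\<dots> = measure (distr M (count_space \<Omega>) (\<xi> 1)) {a}"
    by (simp only: ident[OF assms(1)])
  also have "\<dots> = prob (\<xi> 1 -` {a} \<inter> space M)"
    using assms measurable_letter by (simp add: measure_distr)
  also have "\<xi> 1 -` {a} \<inter> space M = {\<omega>\<in>space M. \<xi> 1 \<omega> = a}" by auto
  finally show ?thesis by (simp add: letter_prob_def)
qed

lemma sum_letter_prob: "sum p \<Omega> = 1"
proof -
  let ?D = "distr M (count_space \<Omega>) (\<xi> 1)"
  interpret D: prob_space ?D using measurable_letter by (intro prob_space_distr) simp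
  have "sum p \<Omega> = (\<Sum>a\<in>\<Omega>. measure ?D {a})"
    using measurable_letter[of 1]
    by (intro sum.cong) (simp_all add: measure_distr prob_letter[of 1] del: One_nat_def)
  also have "\<dots> = measure ?D \<Omega>"
    using finite_letters by (intro D.finite_measure_eq_sum_singleton[symmetric]) auto
  also have "\<dots> = 1" using D.prob_space by simp
  finally show ?thesis .
qed

sublocale pattern_race p \<Omega> A
  by (rule pattern_race.intro)
    (fact finite_letters sum_letter_prob patterns_nonempty patterns_letters patterns_reduced
      | simp add: letter_prob_def)+

lemma outcome_in_words: "\<omega> \<in> space M \<Longrightarrow> outcome n \<omega> \<in> words n"
  using letter_in_alphabet by (auto simp: words_def prefix_word_def)

lemma outcome_eq:
  assumes "w \<in> words n"
  shows "{\<omega>\<in>space M. outcome n \<omega> = w} \<in> events"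
    and "prob {\<omega>\<in>space M. outcome n \<omega> = w} = word_prob p w"
proof -
  have w: "length w = n" "set w \<subseteq> \<Omega>" using assms by (auto simp: words_def)
  let ?E = "\<lambda>k. \<xi> k -` {w ! (k - 1)} \<inter> space M"
  have eq: "{\<omega>\<in>space M. outcome n \<omega> = w} = (\<Inter>k\<in>{1..n}. ?E k)" if "n \<noteq> 0"
    using that w unfolding prefix_word_eq_iff image_Suc_lessThan[symmetric] by auto
  have E: "?E k \<in> events" "prob (?E k) = p (w ! (k - 1))" if "k \<in> {1..n}" for k
  proof -
    have "w ! (k - 1) \<in> \<Omega>" using that w nth_mem[of "k - 1" w] by auto
    then show "?E k \<in> events" "prob (?E k) = p (w ! (k - 1))"
      using that measurable_letter[of k] prob_letter[of k] by (auto intro: measurable_sets)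
  qed
  show "{\<omega>\<in>space M. outcome n \<omega> = w} \<in> events"
  proof (cases "n = 0")
    case True
    then show ?thesis using w by simp
  next
    case False
    then show ?thesis unfolding eq[OF False] using E by (intro sets.finite_INT) auto
  qed
  show "prob {\<omega>\<in>space M. outcome n \<omega> = w} = word_prob p w"
  proof (cases "n = 0")
    case True
    then show ?thesis using w by (simp add: prob_space)
  next
    case False
    have "prob {\<omega>\<in>space M. outcome n \<omega> = w} = (\<Prod>k\<in>{1..n}. prob (?E k))"
      unfolding eq[OF False] using False w
      by (intro indep_varsD[OF indep]) auto
    also have "\<dots> = (\<Prod>k\<in>{1..n}. p (w ! (k - 1)))" using E(2) by (rule prod.cong[OF refl])
    also have "\<dots> = (\<Prod>k\<in>{0..<n}. p (w ! k))"
      by (rule prod.reindex_bij_witness[of _ Suc "\<lambda>k. k - 1"]) auto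
    also have "\<dots> = word_prob p w"
      using w by (simp add: word_prob_def prod.list_conv_set_nth)
    finally show ?thesis .
  qed
qed

lemma outcome_in:
  assumes "S \<subseteq> words n"
  shows "{\<omega>\<in>space M. outcome n \<omega> \<in> S} \<in> events"
    and "prob {\<omega>\<in>space M. outcome n \<omega> \<in> S} = sum (word_prob p) S"
proof -
  have S: "finite S" using assms finite_subset[OF _ finite_words] by blast
  have eq: "{\<omega>\<in>space M. outcome n \<omega> \<in> S} = (\<Union>w\<in>S. {\<omega>\<in>space M. outcome n \<omega> = w})" by auto
  have E: "{\<omega>\<in>space M. outcome n \<omega> = w} \<in> events" "prob {\<omega>\<in>space M. outcome n \<omega> = w} = word_prob p w"
    if "w \<in> S" for w
    using outcome_eq that assms by auto
  show "{\<omega>\<in>space M. outcome n \<omega> \<in> S} \<in> events"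
    unfolding eq using S E(1) by (intro sets.finite_UN) auto
  have "prob (\<Union>w\<in>S. {\<omega>\<in>space M. outcome n \<omega> = w}) = (\<Sum>w\<in>S. prob {\<omega>\<in>space M. outcome n \<omega> = w})"
    using S E(1) by (intro finite_measure_finite_Union) (auto simp: disjoint_family_on_def)
  also have "\<dots> = sum (word_prob p) S" using E(2) by (rule sum.cong[OF refl])
  finally show "prob {\<omega>\<in>space M. outcome n \<omega> \<in> S} = sum (word_prob p) S" by (simp only: eq)
qed

lemma less_first_hit_iff: "enat n < first_hit \<xi> A \<omega> \<longleftrightarrow> avoids (outcome n \<omega>)"
  by (auto simp: first_hit_def less_hit_time_iff nonempty avoids_def)

lemma survival:
  "{\<omega>\<in>space M. enat n < first_hit \<xi> A \<omega>} \<in> events"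
  "prob {\<omega>\<in>space M. enat n < first_hit \<xi> A \<omega>} = surv n"
proof -
  have "{\<omega>\<in>space M. enat n < first_hit \<xi> A \<omega>} = {\<omega>\<in>space M. outcome n \<omega> \<in> avoiding n}"
    using outcome_in_words by (auto simp: less_first_hit_iff avoiding_def)
  then show "{\<omega>\<in>space M. enat n < first_hit \<xi> A \<omega>} \<in> events"
    "prob {\<omega>\<in>space M. enat n < first_hit \<xi> A \<omega>} = surv n"
    using outcome_in[of "avoiding n" n] by (auto simp: avoiding_def surv_def)
qed

text \<open>
  At a positive time \<open>n\<close>, that both \<open>\<tau>\<close> and \<open>\<tau>\<^sub>i\<close> equal \<open>n\<close> is expressed through
  \<open>n - 1 < \<tau>\<close> and \<open>n < \<tau>\<close>, and likewise for \<open>\<tau>\<^sub>i\<close>; such inequalities only ask which patterns the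
  observed words contain. At time 0 both sides are false, as all patterns are nonempty.
\<close>
lemma wins_at_iff:
  assumes "\<omega> \<in> space M"
  shows "first_hit \<xi> A \<omega> = enat n \<and> wins \<xi> A i \<omega> \<longleftrightarrow> outcome n \<omega> \<in> winning i n"
proof (cases n)
  case 0
  have "enat 0 < first_hit \<xi> A \<omega>" by (simp add: less_first_hit_iff)
  then show ?thesis using 0 nonempty[of i] by (auto simp: winning_def)
next
  case (Suc m)
  have "first_hit \<xi> A \<omega> = enat n \<and> wins \<xi> A i \<omega>
      \<longleftrightarrow> first_hit \<xi> A \<omega> = enat (Suc m) \<and> hit_time \<xi> (A i) \<omega> = enat (Suc m)"
    by (auto simp: wins_def Suc)
  also have "\<dots> \<longleftrightarrow> avoids (outcome m \<omega>) \<and> suffix (A i) (outcome (Suc m) \<omega>)"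
    unfolding enat_eq_Suc_iff less_first_hit_iff less_hit_time_iff[OF nonempty]
    using sublist_iff_suffix_or_butlast[of "A i" "outcome (Suc m) \<omega>"]
    by (auto simp: avoids_def)
  finally show ?thesis
    using outcome_in_words[OF assms, of n] by (auto simp: winning_def Suc)
qed

lemma wins_at:
  "{\<omega>\<in>space M. first_hit \<xi> A \<omega> = enat n \<and> wins \<xi> A i \<omega>} \<in> events"
  "prob {\<omega>\<in>space M. first_hit \<xi> A \<omega> = enat n \<and> wins \<xi> A i \<omega>} = win i n"
proof -
  have "{\<omega>\<in>space M. first_hit \<xi> A \<omega> = enat n \<and> wins \<xi> A i \<omega>} = {\<omega>\<in>space M. outcome n \<omega> \<in> winning i n}"
    using wins_at_iff by blast
  then show "{\<omega>\<in>space M. first_hit \<xi> A \<omega> = enat n \<and> wins \<xi> A i \<omega>} \<in> events"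
    "prob {\<omega>\<in>space M. first_hit \<xi> A \<omega> = enat n \<and> wins \<xi> A i \<omega>} = win i n"
    using outcome_in[of "winning i n" n] by (auto simp: winning_def win_def)
qed

lemma prob_wins: "(win i) sums \<P>(\<omega> in M. wins \<xi> A i \<omega>)"
proof -
  let ?E = "\<lambda>n. {\<omega>\<in>space M. first_hit \<xi> A \<omega> = enat n \<and> wins \<xi> A i \<omega>}"
  have "(\<lambda>n. prob (?E n)) sums prob (\<Union>n. ?E n)"
    using wins_at(1) by (intro finite_measure_UNION) (auto simp: disjoint_family_on_def)
  moreover have "(\<Union>n. ?E n) = {\<omega>\<in>space M. wins \<xi> A i \<omega>}"
    by (auto simp: wins_def)
  ultimately show ?thesis by (simp add: wins_at(2))
qed

lemma measurable_first_hit: "first_hit \<xi> A \<in> measurable M (count_space UNIV)"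
proof -
  have fin: "first_hit \<xi> A -` {enat n} \<inter> space M \<in> events" for n
  proof (cases n)
    case 0
    have "first_hit \<xi> A -` {enat n} \<inter> space M = space M - {\<omega>\<in>space M. enat 0 < first_hit \<xi> A \<omega>}"
      using 0 by (auto simp: zero_enat_def[symmetric])
    then show ?thesis using survival(1)[of 0] by auto
  next
    case (Suc m)
    have "first_hit \<xi> A -` {enat n} \<inter> space M =
      {\<omega>\<in>space M. enat m < first_hit \<xi> A \<omega>} - {\<omega>\<in>space M. enat (Suc m) < first_hit \<xi> A \<omega>}"
      unfolding Suc using enat_eq_Suc_iff by auto
    then show ?thesis using survival(1)[of m] survival(1)[of "Suc m"] by auto
  qed
  have "first_hit \<xi> A -` {x} \<inter> space M \<in> events" for x
  proof (cases x)
    case (enat n)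
    then show ?thesis using fin by simp
  next
    case infinity
    have "first_hit \<xi> A -` {\<infinity>} \<inter> space M = space M - (\<Union>n. first_hit \<xi> A -` {enat n} \<inter> space M)"
      by auto
    then show ?thesis unfolding infinity using fin by (simp only:) (intro sets.Diff sets.countable_UN, auto)
  qed
  then show ?thesis by (simp add: measurable_count_space_eq2_countable)
qed

text \<open>
  By the tail formula \<open>E\<tau>\<close> is the sum of the probabilities of \<open>\<tau> > n\<close>, which are \<open>surv n\<close>.
\<close>
lemma exp_first_hit_eq:
  assumes "summable surv"
  shows "exp_first_hit M \<xi> A = ennreal (surv_gf 1)"
proof -
  have "exp_first_hit M \<xi> A = (\<Sum>n. emeasure M {\<omega>\<in>space M. enat n < first_hit \<xi> A \<omega>})"
    unfolding exp_first_hit_def by (rule nn_integral_enat_function[OF measurable_first_hit])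
  also have "\<dots> = (\<Sum>n. ennreal (surv n))"
    by (simp add: emeasure_eq_measure survival(2))
  also have "\<dots> = ennreal (surv_gf 1)"
    using assms by (simp add: surv_gf_def suminf_ennreal2 surv_nonneg)
  finally show ?thesis .
qed

lemma cond_exp_first_hit_eq:
  assumes "summable (\<lambda>n. diffs (win i) n)"
  shows "cond_exp_first_hit M \<xi> A i = ennreal ((\<Sum>n. diffs (win i) n) / \<P>(\<omega> in M. wins \<xi> A i \<omega>))"
proof -
  let ?P = "\<P>(\<omega> in M. wins \<xi> A i \<omega>)"
  have "(\<lambda>n. real (Suc n) * win i (Suc n)) sums (\<Sum>n. diffs (win i) n)"
    using summable_sums[OF assms] by (simp add: diffs_def)
  then have "(\<lambda>n. real n * win i n) sums (\<Sum>n. diffs (win i) n)"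
    by (subst (asm) sums_Suc_iff) simp
  then have s: "(\<lambda>n. real n * win i n / ?P) sums ((\<Sum>n. diffs (win i) n) / ?P)"
    by (rule sums_divide)
  have "of_nat n * ennreal \<P>(\<omega> in M. first_hit \<xi> A \<omega> = enat n \<bar> wins \<xi> A i \<omega>) = ennreal (real n * win i n / ?P)" for n
    by (simp add: cond_prob_def wins_at(2) win_nonneg ennreal_mult' flip: ennreal_of_nat_eq_real_of_nat times_divide_eq_right)
  then have "cond_exp_first_hit M \<xi> A i = (\<Sum>n. ennreal (real n * win i n / ?P))"
    by (simp add: cond_exp_first_hit_def)
  also have "\<dots> = ennreal ((\<Sum>n. diffs (win i) n) / ?P)"
    using s by (simp add: suminf_ennreal2 win_nonneg sums_iff)
  finally show ?thesis .
qed

text \<open>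
  Every word in which \<open>A i\<close> wins ends with \<open>A i\<close>, so its weight has the factor
  \<open>word_prob p (A i)\<close>.
\<close>
lemma word_prob_winner_pos:
  assumes "\<P>(\<omega> in M. wins \<xi> A i \<omega>) > 0"
  shows "word_prob p (A i) > 0"
proof (rule ccontr)
  assume "\<not> word_prob p (A i) > 0"
  then have "word_prob p (A i) = 0" using word_prob_nonneg[OF letters] by (meson antisym not_less)
  then have "win i n = 0" for n
    unfolding win_def by (intro sum.neutral) (auto simp: winning_def suffix_def)
  then have "win i = (\<lambda>_. 0)" by auto
  then show False using prob_wins[of i] assms by (simp add: sums_iff)
qed

end

theorem proposition2p6:
  fixes M :: "'w measure" and \<Omega> :: "'a set" and \<xi> :: "nat \<Rightarrow> 'w \<Rightarrow> 'a"
    and A :: "'m::finite \<Rightarrow> 'a list" and i :: 'm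
  assumes "prob_space M"
    and "finite \<Omega>"
    and "prob_space.indep_vars M (\<lambda>_. count_space \<Omega>) \<xi> {1..}"
    and "\<And>n. n \<ge> 1 \<Longrightarrow> distr M (count_space \<Omega>) (\<xi> n) = distr M (count_space \<Omega>) (\<xi> 1)"
    and "\<And>j. A j \<noteq> []"
    and "\<And>j. set (A j) \<subseteq> \<Omega>"
    and "reduced_patterns A"
    and "\<P>(\<omega> in M. wins \<xi> A i \<omega>) > 0"
  shows "exp_first_hit M \<xi> A < \<infinity> \<and>
    cond_exp_first_hit M \<xi> A i < \<infinity> \<and>
    extend_at_1 (det_ratio (letter_prob M \<xi>) A i) field_differentiable (at 1) \<and>
    enn2real (cond_exp_first_hit M \<xi> A i) =
      enn2real (exp_first_hit M \<xi> A) +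
      1 / \<P>(\<omega> in M. wins \<xi> A i \<omega>) *
      deriv (extend_at_1 (det_ratio (letter_prob M \<xi>) A i)) 1"
proof -
  interpret prob_space M by fact
  interpret iid_pattern_race M \<Omega> \<xi> A
    by (intro iid_pattern_race.intro iid_pattern_race_axioms.intro) (fact assms)+
  let ?P = "\<P>(\<omega> in M. wins \<xi> A i \<omega>)" and ?D = "\<Sum>n. diffs (win i) n"
  have pos: "word_prob p (A i) > 0" using assms(8) by (rule word_prob_winner_pos)
  obtain K where K: "1 < K"
    and sK: "summable (\<lambda>n. surv n * K ^ n)" "\<And>j. summable (\<lambda>n. win j n * K ^ n)"
    using summable_beyond_1[OF pos] by blast
  have sq: "summable surv" using powser_inside[OF sK(1), of 1] K by simp
  have sd: "summable (\<lambda>n. diffs (win i) n)"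
  proof -
    have "summable (\<lambda>n. diffs (win i) n * 1 ^ n)"
      using K powser_inside[OF sK(2)] by (intro termdiff_converges[of _ K]) auto
    then show ?thesis by simp
  qed
  \<comment> \<open>The sum \<open>?D\<close> is the derivative of \<open>win_gf i\<close> at 1: the expectation of \<open>\<tau>\<close> on the event that \<open>A i\<close> wins.\<close>
  have "win_gf i 1 = ?P" using prob_wins[of i] by (simp add: win_gf_def sums_iff)
  then have deriv: "(extend_at_1 (det_ratio p A i) has_field_derivative ?D - ?P * surv_gf 1) (at 1)"
    using det_ratio_deriv[OF pos] by simp
  have "0 \<le> surv_gf 1" unfolding surv_gf_def using sq by (simp add: suminf_nonneg surv_nonneg)
  then have e: "enn2real (exp_first_hit M \<xi> A) = surv_gf 1"
    by (simp add: exp_first_hit_eq[OF sq])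
  have "0 \<le> ?D" using sd by (simp add: suminf_nonneg diffs_def win_nonneg)
  then have c: "enn2real (cond_exp_first_hit M \<xi> A i) = ?D / ?P"
    using assms(8) by (simp add: cond_exp_first_hit_eq[OF sd])
  have "?D / ?P = surv_gf 1 + 1 / ?P * (?D - ?P * surv_gf 1)"
    using assms(8) by (simp add: field_simps)
  then have "enn2real (cond_exp_first_hit M \<xi> A i) = enn2real (exp_first_hit M \<xi> A) +
      1 / ?P * deriv (extend_at_1 (det_ratio p A i)) 1"
    by (simp only: c e DERIV_imp_deriv[OF deriv])
  moreover have "exp_first_hit M \<xi> A < \<infinity>" "cond_exp_first_hit M \<xi> A i < \<infinity>"
    by (simp_all add: exp_first_hit_eq[OF sq] cond_exp_first_hit_eq[OF sd])
  moreover have "extend_at_1 (det_ratio p A i) field_differentiable (at 1)"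
    using deriv by (auto simp: field_differentiable_def)
  ultimately show ?thesis by blast
qed

end
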